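(* Let $\rho$ be one of the four classical discrete weights (Charlier, Meixner, Kravchuk, Hahn), with possibly complex parameters $b,\alpha,\beta$ satisfying Condition D2, let $\rho_m$ be the corresponding shifted weights and $S_\rho$ the corresponding lattice. Let $n\ge 0$ be an integer, with $n\le N$ in the Kravchuk and Hahn cases, and let $C_n\neq 0$ be a constant. Then the function $P_n$ determined by the Rodrigues formula $$P_n(x)\,\rho(x)=C_n\,\nabla^n\rho_n(x)$$ is a polynomial of degree $n$, and it satisfies the orthogonality conditions $$\sum_{x\in S_\rho}P_n(x)\,x^k\,\rho(x)=0,\qquad k=0,1,\dots,n-1,$$ that is, it is orthogonal with respect to the (generally complex-valued) discrete measure $\mu(y)=\sum_{x\in S_\rho}\rho(x)\,\delta(y-x)$.
   Context: Notation: $\mathbb Z_+=\{0,1,2,\dots\}$; $\nabla f(x)=f(x)-f(x-1)$; $(\alpha)_x=\Gamma(x+\alpha)/\Gamma(\alpha)$ (so $(\alpha)_x=\alpha(\alpha+1)\cdots(\alpha+x-1)$ for $x\in\mathbb Z_+$); $1/\Gamma$ is the entire reciprocal Gamma function, vanishing at nonpositive integers; $b^x=e^{x\log b}$ with one fixed value of $\log b$; $\delta$ is the Dirac delta. Classical discrete weights ($\rho=\rho_0$, $m\ge 0$ an integer), lattices $S_\rho$, quotients $u_m(x)=\rho_{m+1}(x)/\rho_m(x)$, $v_m(x)=\rho_{m+1}(x-1)/\rho_m(x)$, and Condition D2: - Charlier: $\rho_m(x)=\dfrac{b^x}{\Gamma(x+1)}$, $S_\rho=\mathbb Z_+$, $u_m=1$,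 $v_m=x/b$. D2: $b\ne0$. - Meixner: $\rho_m(x)=\dfrac{b^x\,\Gamma(x+\alpha+m)}{\Gamma(x+1)}$, $S_\rho=\mathbb Z_+$, $u_m=x+\alpha+m$, $v_m=x/b$. D2: $0<|b|<1$ and $\alpha\notin-\mathbb Z_+=\{0,-1,-2,\dots\}$. - Kravchuk ($N\ge 0$ an integer): $\rho_m(x)=\dfrac{b^x}{\Gamma(x+1)\Gamma(N-m-x+1)}$, $S_\rho=\{0,1,\dots,N\}$, $u_m=N-m-x$, $v_m=x/b$. D2: $b\neq0$, $b\ne-1$. - Hahn ($N\ge 0$ an integer): $\rho_m(x)=\dfrac{(\alpha+m)_x\,(\beta+m)_{N-m-x}}{\Gamma(x+1)\Gamma(N-m-x+1)}$, $S_\rho=\{0,1,\dots,N\}$, $u_m=\dfrac{(x+\alpha+m)(N-m-x)}{(\alpha+m)(\beta+m)}$, $v_m=\dfrac{x(N-x+\beta)}{(\alpha+m)(\beta+m)}$. D2: $\alpha,\beta\notin\{0,-1,\dots,1-N\}$ and $-\alpha-\beta\notin\{0,1,\dots,2N-2\}$. The Rodrigues formula is understood as an identity of meromorphic functions of $x$, i.e. $P_n(x)=C_n\sum_{k=0}^n(-1)^k\binom nk\dfrac{\rho_n(x-k)}{\rho(x)}$, where the quotients are computed from the listed $u_m,v_m$: $\dfrac{\rho_n(x-k)}{\rho(x)}=\prod_{i=0}^{k-1}v_i(x-i)\prod_{i=k}^{n-1}u_i(x-k)$. In the Hahn case with $\alpha$ or $\beta$ a nonpositive integer the quotients are understood in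 this way, and the values of $\rho$ on $S_\rho$ are computed with the product formula for $(\alpha)_x$, $(\beta)_{N-x}$. *)

theory Defs
  imports "HOL-Analysis.Analysis" "HOL-Computational_Algebra.Polynomial"
begin

(* Parameters: Charlier b lb, Meixner b lb alpha, Kravchuk N b lb, Hahn N alpha beta.
   The parameter lb is the fixed value of log b, so that b^x is exp (x * lb);
   it is constrained by log_branch below. *)
datatype classical_weight =
    Charlier complex complex
  | Meixner complex complex complex
  | Kravchuk nat complex complex
  | Hahn nat complex complex

fun log_branch :: "classical_weight \<Rightarrow> bool" where
  "log_branch (Charlier b lb) \<longleftrightarrow> exp lb = b"
| "log_branch (Meixner b lb \<alpha>) \<longleftrightarrow> exp lb = b"
| "log_branch (Kravchuk N b lb) \<longleftrightarrow> exp lb = b"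
| "log_branch (Hahn N \<alpha> \<beta>) \<longleftrightarrow> True"

(* In the Hahn case the excluded values are 0, -1, ..., 1 - N for alpha, beta and
   0, 1, ..., 2 N - 2 for -alpha - beta; both ranges are empty if N = 0. *)
fun condition_D2 :: "classical_weight \<Rightarrow> bool" where
  "condition_D2 (Charlier b lb) \<longleftrightarrow> b \<noteq> 0"
| "condition_D2 (Meixner b lb \<alpha>) \<longleftrightarrow> 0 < norm b \<and> norm b < 1 \<and> \<alpha> \<notin> \<int>\<^sub>\<le>\<^sub>0"
| "condition_D2 (Kravchuk N b lb) \<longleftrightarrow> b \<noteq> 0 \<and> b \<noteq> -1"
| "condition_D2 (Hahn N \<alpha> \<beta>) \<longleftrightarrow>
     (\<forall>j::nat. j + 1 \<le> N \<longrightarrow> \<alpha> \<noteq> - of_nat j \<and> \<beta> \<noteq> - of_nat j) \<and>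
     (\<forall>j::nat. j + 2 \<le> 2 * N \<longrightarrow> - \<alpha> - \<beta> \<noteq> of_nat j)"

(* The points of the lattice S_rho are nonnegative integers. *)
fun lattice_points :: "classical_weight \<Rightarrow> nat set" where
  "lattice_points (Charlier b lb) = UNIV"
| "lattice_points (Meixner b lb \<alpha>) = UNIV"
| "lattice_points (Kravchuk N b lb) = {0..N}"
| "lattice_points (Hahn N \<alpha> \<beta>) = {0..N}"

fun admissible_degree :: "classical_weight \<Rightarrow> nat \<Rightarrow> bool" where
  "admissible_degree (Charlier b lb) n \<longleftrightarrow> True"
| "admissible_degree (Meixner b lb \<alpha>) n \<longleftrightarrow> True"
| "admissible_degree (Kravchuk N b lb) n \<longleftrightarrow> n \<le> N"
| "admissible_degree (Hahn N \<alpha> \<beta>) n \<longleftrightarrow> n \<le> N"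

(* (a)_x for complex x: the product formula if x is a nonnegative integer (this also
   covers the case that a is a pole of Gamma), the Gamma quotient otherwise. The two
   agree where both make sense, see rising_Gamma. *)
definition rising :: "complex \<Rightarrow> complex \<Rightarrow> complex" where
  "rising a x = (if x \<in> \<nat> then pochhammer a (THE n. x = of_nat n) else Gamma (x + a) / Gamma a)"

fun weight :: "classical_weight \<Rightarrow> nat \<Rightarrow> complex \<Rightarrow> complex" where
  "weight (Charlier b lb) m x = exp (x * lb) * rGamma (x + 1)"
| "weight (Meixner b lb \<alpha>) m x = exp (x * lb) * Gamma (x + \<alpha> + of_nat m) * rGamma (x + 1)"
| "weight (Kravchuk N b lb) m x =
     exp (x * lb) * rGamma (x + 1) * rGamma (of_nat N - of_nat m - x + 1)"
| "weight (Hahn N \<alpha> \<beta>) m x =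
     rising (\<alpha> + of_nat m) x * rising (\<beta> + of_nat m) (of_nat N - of_nat m - x)
       * rGamma (x + 1) * rGamma (of_nat N - of_nat m - x + 1)"

(* u_m(x) = rho_{m+1}(x) / rho_m(x) and v_m(x) = rho_{m+1}(x-1) / rho_m(x),
   see weight_Suc and weight_Suc_shift. *)
fun u_quot :: "classical_weight \<Rightarrow> nat \<Rightarrow> complex \<Rightarrow> complex" where
  "u_quot (Charlier b lb) m x = 1"
| "u_quot (Meixner b lb \<alpha>) m x = x + \<alpha> + of_nat m"
| "u_quot (Kravchuk N b lb) m x = of_nat N - of_nat m - x"
| "u_quot (Hahn N \<alpha> \<beta>) m x =
     (x + \<alpha> + of_nat m) * (of_nat N - of_nat m - x) / ((\<alpha> + of_nat m) * (\<beta> + of_nat m))"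

fun v_quot :: "classical_weight \<Rightarrow> nat \<Rightarrow> complex \<Rightarrow> complex" where
  "v_quot (Charlier b lb) m x = x / b"
| "v_quot (Meixner b lb \<alpha>) m x = x / b"
| "v_quot (Kravchuk N b lb) m x = x / b"
| "v_quot (Hahn N \<alpha> \<beta>) m x =
     x * (of_nat N - x + \<beta>) / ((\<alpha> + of_nat m) * (\<beta> + of_nat m))"

(* The meromorphic function rho_n(x-k) / rho(x) for k <= n. *)
definition weight_ratio :: "classical_weight \<Rightarrow> nat \<Rightarrow> nat \<Rightarrow> complex \<Rightarrow> complex" where
  "weight_ratio w n k x =
     (\<Prod>i<k. v_quot w i (x - of_nat i)) * (\<Prod>i=k..<n. u_quot w i (x - of_nat k))"

(* C nabla^n rho_n / rho with nabla^n expanded; the literal formula away from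
   singularities is rodrigues_formula below. *)
definition rodrigues :: "classical_weight \<Rightarrow> nat \<Rightarrow> complex \<Rightarrow> complex \<Rightarrow> complex" where
  "rodrigues w n C x =
     C * (\<Sum>k\<le>n. (-1) ^ k * of_nat (n choose k) * weight_ratio w n k x)"

definition nabla :: "(complex \<Rightarrow> complex) \<Rightarrow> complex \<Rightarrow> complex" where
  "nabla f x = f x - f (x - 1)"

(* Excludes the points where the formulas for the weights meet poles of Gamma, and
   the Hahn parameters for which Gamma(alpha), Gamma(beta) do not exist. *)
fun generic_point :: "classical_weight \<Rightarrow> complex \<Rightarrow> bool" where
  "generic_point (Charlier b lb) x \<longleftrightarrow> True"
| "generic_point (Meixner b lb \<alpha>) x \<longleftrightarrow> x + \<alpha> \<notin> \<int>"
| "generic_point (Kravchuk N b lb) x \<longleftrightarrow> True"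
| "generic_point (Hahn N \<alpha> \<beta>) x \<longleftrightarrow>
     \<alpha> \<notin> \<int>\<^sub>\<le>\<^sub>0 \<and> \<beta> \<notin> \<int>\<^sub>\<le>\<^sub>0 \<and> x \<notin> \<int> \<and> x + \<alpha> \<notin> \<int> \<and> x - \<beta> \<notin> \<int>"

lemma rising_of_nat [simp]: "rising a (of_nat n) = pochhammer a n"
  by (simp add: rising_def)

lemma rising_Gamma:
  assumes "a \<notin> \<int>\<^sub>\<le>\<^sub>0"
  shows "rising a x = Gamma (x + a) / Gamma a"
proof (cases "x \<in> \<nat>")
  case True
  then obtain n where "x = of_nat n" by (auto elim: Nats_cases)
  then show ?thesis using assms by (simp add: pochhammer_Gamma add.commute)
qed (simp add: rising_def)

lemma weight_Hahn_lattice: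
  assumes "x \<le> N"
  shows "weight (Hahn N \<alpha> \<beta>) 0 (of_nat x) =
           pochhammer \<alpha> x * pochhammer \<beta> (N - x) / (fact x * fact (N - x))"
proof -
  have 1: "(of_nat N - of_nat x :: complex) = of_nat (N - x)"
    using assms by simp
  have 2: "rGamma (of_nat k + 1 :: complex) = 1 / fact k" for k
    by (simp add: rGamma_inverse_Gamma Gamma_fact field_simps)
  show ?thesis
    by (simp add: 1 2 del: of_nat_diff)
qed

lemma add_nat_notin_nonpos_Ints:
  fixes a :: complex
  assumes "a \<notin> \<int>\<^sub>\<le>\<^sub>0"
  shows "a + of_nat m \<notin> \<int>\<^sub>\<le>\<^sub>0"
  using assms nonpos_Ints_diff_Nats[of "a + of_nat m" "of_nat m"] by auto

lemma Ints_shift_iff [simp]: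
  "(x::complex) + of_nat m \<in> \<int> \<longleftrightarrow> x \<in> \<int>"
  "(x::complex) - of_nat m \<in> \<int> \<longleftrightarrow> x \<in> \<int>"
  by (metis Ints_add Ints_diff Ints_of_nat add_diff_cancel_right')
     (metis Ints_add Ints_diff Ints_of_nat diff_add_cancel)

lemma generic_point_shift: "generic_point w x \<Longrightarrow> generic_point w (x - of_nat k)"
proof (induction w)
  case (Meixner b lb \<alpha>)
  have "x - of_nat k + \<alpha> = x + \<alpha> - of_nat k" by simp
  then show ?case using Meixner by (simp only: generic_point.simps Ints_shift_iff simp_thms)
next
  case (Hahn N \<alpha> \<beta>)
  have "x - of_nat k + \<alpha> = x + \<alpha> - of_nat k" "x - of_nat k - \<beta> = x - \<beta> - of_nat k" by simp_all
  then show ?case using Hahn by (simp only: generic_point.simps Ints_shift_iff simp_thms)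
qed simp_all

lemma Hahn_rising_facts:
  fixes a :: complex
  assumes "a \<notin> \<int>\<^sub>\<le>\<^sub>0" "x + a \<notin> \<int>"
  shows "rising (a + 1) x = (x + a) / a * rising a x"
    and "rising (a + 1) (x - 1) = rising a x / a"
proof -
  have a: "a \<noteq> 0" "Gamma (a + 1) = a * Gamma a" "a + 1 \<notin> \<int>\<^sub>\<le>\<^sub>0" "Gamma a \<noteq> 0"
    using assms add_nat_notin_nonpos_Ints[of a 1] by (auto simp: Gamma_plus1 Gamma_eq_zero_iff)
  have "x + a \<notin> \<int>\<^sub>\<le>\<^sub>0" using assms by auto
  then have x: "Gamma (x + a + 1) = (x + a) * Gamma (x + a)"
    by (rule Gamma_plus1)
  show "rising (a + 1) x = (x + a) / a * rising a x"
    using a x assms by (simp add: rising_Gamma field_simps)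
  show "rising (a + 1) (x - 1) = rising a x / a"
    using a assms by (simp add: rising_Gamma field_simps)
qed

lemma
  assumes "log_branch w" "generic_point w x"
  shows weight_Suc: "weight w (Suc m) x = u_quot w m x * weight w m x"
    and weight_Suc_shift: "weight w (Suc m) (x - 1) = v_quot w m x * weight w m x"
proof -
  have x: "x * rGamma (x + 1) = rGamma x" by (rule rGamma_plus1)
  have e: "exp ((x - 1) * l) = exp (x * l) / exp l" for l :: complex
    by (simp add: algebra_simps exp_diff)
  have "weight w (Suc m) x = u_quot w m x * weight w m x \<and>
        weight w (Suc m) (x - 1) = v_quot w m x * weight w m x"
  proof (cases w)
    case (Charlier b lb)
    then show ?thesis using assms by (auto simp: e x[symmetric])
  next
    case (Meixner b lb \<alpha>)
    have "x + \<alpha> + of_nat m \<notin> \<int>" using assms Meixner by simp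
    then have "x + \<alpha> + of_nat m \<notin> \<int>\<^sub>\<le>\<^sub>0" by auto
    then have "Gamma (x + \<alpha> + of_nat m + 1) = (x + \<alpha> + of_nat m) * Gamma (x + \<alpha> + of_nat m)"
      by (rule Gamma_plus1)
    then show ?thesis using assms Meixner
      by (auto simp: e x[symmetric] add_ac)
  next
    case (Kravchuk N b lb)
    define y where "y = of_nat N - of_nat m - x"
    have y: "y * rGamma (y + 1) = rGamma y" by (rule rGamma_plus1)
    have "of_nat N - of_nat (Suc m) - x + 1 = y" "of_nat N - of_nat (Suc m) - (x - 1) + 1 = y + 1"
      by (simp_all add: y_def)
    then show ?thesis using assms Kravchuk y
      by (auto simp: e x[symmetric] y_def[symmetric] simp del: of_nat_Suc)
  next
    case (Hahn N \<alpha> \<beta>)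
    define y where "y = of_nat N - of_nat m - x"
    define c where "c = \<alpha> + of_nat m"
    define d where "d = \<beta> + of_nat m"
    have y: "y * rGamma (y + 1) = rGamma y" by (rule rGamma_plus1)
    have eqs: "of_nat N - of_nat (Suc m) - x = y - 1" "of_nat N - of_nat (Suc m) - (x - 1) = y"
      "\<alpha> + of_nat (Suc m) = c + 1" "\<beta> + of_nat (Suc m) = d + 1" "of_nat N - of_nat m - x = y"
      by (simp_all add: y_def c_def d_def)
    have g: "\<alpha> \<notin> \<int>\<^sub>\<le>\<^sub>0" "\<beta> \<notin> \<int>\<^sub>\<le>\<^sub>0" "x + \<alpha> \<notin> \<int>" "x - \<beta> \<notin> \<int>"
      using assms Hahn by auto
    have c: "c \<notin> \<int>\<^sub>\<le>\<^sub>0" "d \<notin> \<int>\<^sub>\<le>\<^sub>0"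
      unfolding c_def d_def using g by (auto intro!: add_nat_notin_nonpos_Ints)
    have "x + c = x + \<alpha> + of_nat m" by (simp add: c_def)
    then have xc: "x + c \<notin> \<int>" using g by (simp only: Ints_shift_iff simp_thms)
    have "y + d = of_nat N - (x - \<beta>)" by (simp add: y_def d_def)
    then have yd: "y + d \<notin> \<int>"
      using g(4) by (metis Ints_diff Ints_of_nat diff_diff_eq2 add_diff_cancel_left')
    have uv: "u_quot w m x = (x + c) * y / (c * d)" "v_quot w m x = x * (y + d) / (c * d)"
      by (simp_all add: Hahn c_def d_def y_def algebra_simps)
    have W: "weight w m x = rising c x * rising d y * rGamma (x + 1) * rGamma (y + 1)"
      "weight w (Suc m) x = rising (c + 1) x * rising (d + 1) (y - 1) * rGamma (x + 1) * rGamma y"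
      "weight w (Suc m) (x - 1) =
         rising (c + 1) (x - 1) * rising (d + 1) y * rGamma x * rGamma (y + 1)"
      by (simp_all only: Hahn weight.simps eqs c_def[symmetric] d_def[symmetric]) simp_all
    show ?thesis
      unfolding W uv Hahn_rising_facts[OF c(1) xc] Hahn_rising_facts[OF c(2) yd]
        x[symmetric] y[symmetric] by simp
  qed
  then show "weight w (Suc m) x = u_quot w m x * weight w m x"
    and "weight w (Suc m) (x - 1) = v_quot w m x * weight w m x" by auto
qed

lemma weight_ratio_correct:
  assumes "log_branch w" "generic_point w x" "k \<le> n"
  shows "weight w n (x - of_nat k) = weight_ratio w n k x * weight w 0 x"
proof -
  have v: "weight w k (x - of_nat k) = (\<Prod>i<k. v_quot w i (x - of_nat i)) * weight w 0 x" for k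
  proof (induction k)
    case (Suc k)
    have "weight w (Suc k) (x - of_nat k - 1) = v_quot w k (x - of_nat k) * weight w k (x - of_nat k)"
      by (intro weight_Suc_shift assms generic_point_shift)
    then show ?case using Suc by (simp add: algebra_simps)
  qed simp
  show ?thesis using assms(3)
  proof (induction n rule: dec_induct)
    case base
    then show ?case by (simp add: v weight_ratio_def)
  next
    case (step n)
    have "weight w (Suc n) (x - of_nat k) = u_quot w n (x - of_nat k) * weight w n (x - of_nat k)"
      by (intro weight_Suc assms generic_point_shift)
    then show ?case using step by (simp add: weight_ratio_def)
  qed
qed

lemma funpow_nabla:
  "(nabla ^^ n) f x = (\<Sum>k\<le>n. (-1) ^ k * of_nat (n choose k) * f (x - of_nat k))"
proof (induction n arbitrary: x)
  case (Suc n)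
  have "(nabla ^^ Suc n) f x =
      (\<Sum>k\<le>n. (-1) ^ k * of_nat (n choose k) * f (x - of_nat k))
    + (\<Sum>k\<le>n. (-1) ^ Suc k * of_nat (n choose k) * f (x - of_nat (Suc k)))"
    by (simp add: nabla_def Suc sum_negf algebra_simps)
  also have "(\<Sum>k\<le>n. (-1) ^ k * of_nat (n choose k) * f (x - of_nat k)) =
      (\<Sum>k\<le>Suc n. (-1) ^ k * of_nat (n choose k) * f (x - of_nat k))"
    by simp
  also have "\<dots> = f x + (\<Sum>k\<le>n. (-1) ^ Suc k * of_nat (n choose Suc k) * f (x - of_nat (Suc k)))"
    by (subst sum.atMost_Suc_shift) simp
  also have "\<dots> + (\<Sum>k\<le>n. (-1) ^ Suc k * of_nat (n choose k) * f (x - of_nat (Suc k))) =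
      f x + (\<Sum>k\<le>n. (-1) ^ Suc k * of_nat (Suc n choose Suc k) * f (x - of_nat (Suc k)))"
    by (simp add: sum.distrib[symmetric] algebra_simps del: sum.atMost_Suc of_nat_Suc power_Suc)
  also have "\<dots> = (\<Sum>k\<le>Suc n. (-1) ^ k * of_nat (Suc n choose k) * f (x - of_nat k))"
    by (subst sum.atMost_Suc_shift) simp
  finally show ?case .
qed simp

lemma rodrigues_formula:
  assumes "log_branch w" "generic_point w x"
  shows "rodrigues w n C x * weight w 0 x = C * (nabla ^^ n) (weight w n) x"
  unfolding rodrigues_def funpow_nabla
  by (simp add: sum_distrib_right weight_ratio_correct[OF assms] mult.assoc)

end

theory Submission
  imports Defs "HOL-Real_Asymp.Real_Asymp"
begin

text \<open>
  Put \<open>P\<^sub>n\<^sub>,\<^sub>n = 1\<close> and \<open>P\<^sub>m\<^sub>,\<^sub>n \<rho>\<^sub>m = \<nabla> (P\<^sub>m\<^sub>+\<^sub>1\<^sub>,\<^sub>n \<rho>\<^sub>m\<^sub>+\<^sub>1)\<close>, that is,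
  \<open>P\<^sub>m\<^sub>,\<^sub>n(x) = u\<^sub>m(x) P\<^sub>m\<^sub>+\<^sub>1\<^sub>,\<^sub>n(x) - v\<^sub>m(x) P\<^sub>m\<^sub>+\<^sub>1\<^sub>,\<^sub>n(x - 1)\<close>. The polynomials \<open>u\<^sub>m\<close> and \<open>v\<^sub>m\<close> have
  the same quadratic coefficient, so each such step raises the degree by at most one, and Condition D2
  says that the new leading coefficient does not vanish. Since \<open>v\<^sub>m(0) = 0\<close> and the weights
  vanish to the right of a finite lattice, summation by parts on the nonnegative integers has no
  boundary terms: it moves one \<open>\<nabla>\<close> onto the test polynomial, and \<open>n\<close> differences annihilate a
  polynomial of degree less than \<open>n\<close>.
\<close>

section \<open>Polynomials under a shift of the argument\<close>

text \<open>These are the top two terms of (x + t)^(d+1) = x^(d+1) + (d+1) t x^d + ...; the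
  induction peels off one Horner step.\<close>

lemma coeff_pcompose_shift:
  fixes p :: "'a::comm_ring_1 poly"
  assumes "degree p \<le> Suc d"
  shows "coeff (pcompose p [:t, 1:]) (Suc d) = coeff p (Suc d)"
    and "coeff (pcompose p [:t, 1:]) d = coeff p d + of_nat (Suc d) * t * coeff p (Suc d)"
proof -
  have "coeff (pcompose p [:t, 1:]) (Suc d) = coeff p (Suc d) \<and>
        coeff (pcompose p [:t, 1:]) d = coeff p d + of_nat (Suc d) * t * coeff p (Suc d)"
    using assms
  proof (induction d arbitrary: p)
    case 0
    obtain a q where p: "p = pCons a q" by (cases p)
    then have "degree q = 0" using 0 by (auto split: if_splits)
    then obtain c where "q = [:c:]" by (auto elim: degree_eq_zeroE)
    then show ?case by (simp add: p pcompose_pCons)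
  next
    case (Suc d)
    obtain a q where p: "p = pCons a q" by (cases p)
    then have q: "degree q \<le> Suc d" using Suc.prems by (auto split: if_splits)
    have "degree (pcompose q [:t, 1:]) \<le> Suc d"
      using degree_pcompose_le[of q "[:t, 1:]"] q by (simp add: order.trans)
    then have "coeff (pcompose q [:t, 1:]) (Suc (Suc d)) = 0"
      by (simp add: coeff_eq_0)
    then show ?case
      using Suc.IH[OF q] by (simp add: p pcompose_pCons algebra_simps)
  qed
  then show "coeff (pcompose p [:t, 1:]) (Suc d) = coeff p (Suc d)"
    and "coeff (pcompose p [:t, 1:]) d = coeff p d + of_nat (Suc d) * t * coeff p (Suc d)"
    by auto
qed

text \<open>Leading coefficients cancel. The first alternative matters for \<open>d = 0\<close>:
  there the difference is the zero polynomial, whose degree 0 is not below \<open>d\<close>.\<close>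

lemma degree_diff_pcompose_shift_less:
  fixes q :: "'a::comm_ring_1 poly"
  assumes "degree q < Suc d"
  shows "q = pcompose q [:t, 1:] \<or> degree (q - pcompose q [:t, 1:]) < d"
proof (cases d)
  case 0
  then obtain c where "q = [:c:]" using assms by (auto elim: degree_eq_zeroE)
  then show ?thesis by simp
next
  case (Suc e)
  have q: "degree q \<le> Suc e" using assms Suc by simp
  moreover have "degree (pcompose q [:t, 1:]) \<le> Suc e"
    using degree_pcompose_le[of q "[:t, 1:]"] q by (simp add: order.trans)
  ultimately have "degree (q - pcompose q [:t, 1:]) \<le> Suc e"
    by (rule degree_diff_le)
  moreover have "coeff (q - pcompose q [:t, 1:]) (Suc e) = 0"
    using coeff_pcompose_shift(1)[OF q] by simp
  ultimately have "degree (q - pcompose q [:t, 1:]) < Suc e \<or> q - pcompose q [:t, 1:] = 0"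
    by (metis leading_coeff_0_iff le_neq_implies_less)
  then show ?thesis unfolding Suc by auto
qed

text \<open>The common \<open>c\<close> cancels in degree d + 2. In degree d + 1 it multiplies the
  difference of the coefficients of x^(d-1) in p(x) and p(x - 1), which is
  \<open>of_nat d * coeff p d\<close>.\<close>

lemma degree_coeff_backward_step:
  fixes p :: "'a::comm_ring_1 poly" and a b c a' b' :: 'a
  defines "q \<equiv> [:a, b, c:] * p - [:a', b', c:] * pcompose p [:- 1, 1:]"
  assumes p: "degree p \<le> d"
  shows "degree q \<le> Suc d" and "coeff q (Suc d) = (b - b' + of_nat d * c) * coeff p d"
proof -
  have shift: "degree (pcompose p [:- 1, 1:]) \<le> d"
    using degree_pcompose_le[of p "[:- 1, 1:]"] p by (simp add: order.trans)
  have top: "coeff (pcompose p [:- 1, 1:]) d = coeff p d"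
  proof (cases d)
    case 0
    then obtain e where "p = [:e:]" using p by (auto elim: degree_eq_zeroE)
    then show ?thesis by simp
  qed (use coeff_pcompose_shift(1) p in blast)
  have zero: "coeff p i = 0" "coeff (pcompose p [:- 1, 1:]) i = 0" if "i > d" for i
    using that p shift by (auto intro: coeff_eq_0)
  show "degree q \<le> Suc d"
  proof (rule degree_le, intro allI impI)
    fix i assume "Suc d < i"
    moreover define j where "j = i - 2"
    ultimately have "i = Suc (Suc j)" "j \<ge> d" by simp_all
    then show "coeff q i = 0"
      using zero top by (cases "j = d") (auto simp: q_def)
  qed
  show "coeff q (Suc d) = (b - b' + of_nat d * c) * coeff p d"
  proof (cases d)
    case 0
    then show ?thesis using zero top by (simp add: q_def algebra_simps)
  next
    case (Suc e)
    have "coeff p e = coeff (pcompose p [:- 1, 1:]) e + of_nat d * coeff p d"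
      using coeff_pcompose_shift(2)[of p e "- 1"] p Suc by (simp add: algebra_simps)
    then show ?thesis using zero top by (simp add: q_def Suc algebra_simps)
  qed
qed

section \<open>Iterated backward steps\<close>

fun quot_linear_u :: "classical_weight \<Rightarrow> nat \<Rightarrow> complex" where
  "quot_linear_u (Charlier b lb) m = 0"
| "quot_linear_u (Meixner b lb \<alpha>) m = 1"
| "quot_linear_u (Kravchuk N b lb) m = - 1"
| "quot_linear_u (Hahn N \<alpha> \<beta>) m =
     (of_nat N - of_nat m - \<alpha> - of_nat m) / ((\<alpha> + of_nat m) * (\<beta> + of_nat m))"

fun quot_linear_v :: "classical_weight \<Rightarrow> nat \<Rightarrow> complex" where
  "quot_linear_v (Charlier b lb) m = 1 / b"
| "quot_linear_v (Meixner b lb \<alpha>) m = 1 / b"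
| "quot_linear_v (Kravchuk N b lb) m = 1 / b"
| "quot_linear_v (Hahn N \<alpha> \<beta>) m =
     (of_nat N + \<beta>) / ((\<alpha> + of_nat m) * (\<beta> + of_nat m))"

fun quot_quadratic :: "classical_weight \<Rightarrow> nat \<Rightarrow> complex" where
  "quot_quadratic (Hahn N \<alpha> \<beta>) m = - 1 / ((\<alpha> + of_nat m) * (\<beta> + of_nat m))"
| "quot_quadratic w m = 0"

definition u_poly :: "classical_weight \<Rightarrow> nat \<Rightarrow> complex poly" where
  "u_poly w m = [:u_quot w m 0, quot_linear_u w m, quot_quadratic w m:]"

definition v_poly :: "classical_weight \<Rightarrow> nat \<Rightarrow> complex poly" where
  "v_poly w m = [:0, quot_linear_v w m, quot_quadratic w m:]"

lemma poly_u_poly: "poly (u_poly w m) x = u_quot w m x"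
  by (cases w) (auto simp: u_poly_def divide_inverse algebra_simps)

lemma poly_v_poly: "poly (v_poly w m) x = v_quot w m x"
  by (cases w) (auto simp: v_poly_def divide_inverse algebra_simps)

lemma v_quot_0 [simp]: "v_quot w m 0 = 0"
  by (cases w) auto

text \<open>Both sides equal \<open>\<rho>\<^sub>m\<^sub>+\<^sub>2(x - 1) / \<rho>\<^sub>m(x)\<close>.\<close>
lemma quot_compat: "u_quot w m x * v_quot w (Suc m) x = u_quot w (Suc m) (x - 1) * v_quot w m x"
proof (cases w)
  case (Hahn N \<alpha> \<beta>)
  have "x - 1 + \<alpha> + of_nat (Suc m) = x + \<alpha> + of_nat m"
    "of_nat N - of_nat (Suc m) - (x - 1) = of_nat N - of_nat m - x"
    by simp_all
  then show ?thesis by (simp only: Hahn u_quot.simps v_quot.simps times_divide_times_eq mult_ac)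
qed simp_all

text \<open>This is P with indices m and m + d; counting the remaining steps d makes the recursion
  structural.\<close>

primrec backward_poly :: "classical_weight \<Rightarrow> nat \<Rightarrow> nat \<Rightarrow> complex poly" where
  "backward_poly w 0 m = 1"
| "backward_poly w (Suc d) m =
     u_poly w m * backward_poly w d (Suc m)
     - v_poly w m * pcompose (backward_poly w d (Suc m)) [:- 1, 1:]"

text \<open>The meromorphic function \<open>\<rho>\<^sub>m\<^sub>+\<^sub>d(x - k) / \<rho>\<^sub>m(x)\<close>.\<close>
definition shifted_ratio :: "classical_weight \<Rightarrow> nat \<Rightarrow> nat \<Rightarrow> nat \<Rightarrow> complex \<Rightarrow> complex" where
  "shifted_ratio w m d k x =
     (\<Prod>i<k. v_quot w (m + i) (x - of_nat i)) * (\<Prod>i=k..<d. u_quot w (m + i) (x - of_nat k))"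

lemma shifted_ratio_v:
  "v_quot w m x * shifted_ratio w (Suc m) d k (x - 1) = shifted_ratio w m (Suc d) (Suc k) x"
  unfolding shifted_ratio_def prod.lessThan_Suc_shift prod.shift_bounds_Suc_ivl
  by (simp add: algebra_simps)

text \<open>\<open>quot_compat\<close> moves the \<open>u\<close> factor past one \<open>v\<close>
  factor at a time, raising the index of \<open>u\<close>, shifting its argument and lowering the
  index of that \<open>v\<close>.\<close>

lemma u_quot_prod_v_quot:
  "u_quot w m x * (\<Prod>i<k. v_quot w (Suc m + i) (x - of_nat i)) =
   u_quot w (m + k) (x - of_nat k) * (\<Prod>i<k. v_quot w (m + i) (x - of_nat i))"
proof (induction k)
  case (Suc k)
  have "u_quot w m x * (\<Prod>i<Suc k. v_quot w (Suc m + i) (x - of_nat i)) =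
      (u_quot w (m + k) (x - of_nat k) * v_quot w (Suc (m + k)) (x - of_nat k))
      * (\<Prod>i<k. v_quot w (m + i) (x - of_nat i))"
    using Suc by (simp add: algebra_simps)
  then show ?case
    unfolding quot_compat by (simp add: algebra_simps)
qed simp

lemma shifted_ratio_u:
  assumes "k \<le> d"
  shows "u_quot w m x * shifted_ratio w (Suc m) d k x = shifted_ratio w m (Suc d) k x"
proof -
  \<comment> \<open>The factor \<open>i = k\<close> split off here is the one that
    \<open>u_quot_prod_v_quot\<close> produces.\<close>
  have "(\<Prod>i=k..<Suc d. u_quot w (m + i) (x - of_nat k)) =
      u_quot w (m + k) (x - of_nat k) * (\<Prod>i=k..<d. u_quot w (Suc m + i) (x - of_nat k))"
    using assms by (simp add: prod.atLeast_Suc_lessThan prod.shift_bounds_Suc_ivl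
        del: prod.op_ivl_Suc)
  then show ?thesis
    unfolding shifted_ratio_def mult.assoc[symmetric] u_quot_prod_v_quot
    by (simp add: mult_ac del: prod.op_ivl_Suc)
qed

text \<open>Pascal's rule: in the recursion the \<open>u\<close> term keeps k and the
  \<open>v\<close> term raises it. No weight is evaluated, so poles of the weights do not
  matter.\<close>

lemma poly_backward_poly:
  "poly (backward_poly w d m) x =
   (\<Sum>k\<le>d. (-1) ^ k * of_nat (d choose k) * shifted_ratio w m d k x)"
proof (induction d arbitrary: m x)
  case 0
  then show ?case by (simp add: shifted_ratio_def)
next
  case (Suc d)
  let ?r = "shifted_ratio w m (Suc d)"
  have "poly (backward_poly w (Suc d) m) x =
      u_quot w m x * poly (backward_poly w d (Suc m)) x
      - v_quot w m x * poly (backward_poly w d (Suc m)) (x - 1)"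
    by (simp add: poly_u_poly poly_v_poly poly_pcompose)
  also have "u_quot w m x * poly (backward_poly w d (Suc m)) x =
      (\<Sum>k\<le>d. (-1) ^ k * of_nat (d choose k) * ?r k x)"
    unfolding Suc sum_distrib_left
    by (intro sum.cong refl) (simp add: shifted_ratio_u[symmetric] mult_ac)
  \<comment> \<open>The added term is 0 since \<open>d choose Suc d = 0\<close>; splitting off
    \<open>k = 0\<close> then aligns the two sums.\<close>
  also have "\<dots> = (\<Sum>k\<le>Suc d. (-1) ^ k * of_nat (d choose k) * ?r k x)"
    by simp
  also have "\<dots> = ?r 0 x + (\<Sum>k\<le>d. (-1) ^ Suc k * of_nat (d choose Suc k) * ?r (Suc k) x)"
    by (subst sum.atMost_Suc_shift) simp
  also have "v_quot w m x * poly (backward_poly w d (Suc m)) (x - 1) =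
      (\<Sum>k\<le>d. (-1) ^ k * of_nat (d choose k) * ?r (Suc k) x)"
    unfolding Suc sum_distrib_left
    by (intro sum.cong refl) (simp add: shifted_ratio_v[symmetric] mult_ac)
  also have "?r 0 x + (\<Sum>k\<le>d. (-1) ^ Suc k * of_nat (d choose Suc k) * ?r (Suc k) x)
      - (\<Sum>k\<le>d. (-1) ^ k * of_nat (d choose k) * ?r (Suc k) x) =
      ?r 0 x + (\<Sum>k\<le>d. (-1) ^ Suc k * of_nat (Suc d choose Suc k) * ?r (Suc k) x)"
    by (simp add: sum_subtractf[symmetric] sum_negf[symmetric] sum.distrib[symmetric] algebra_simps
        del: sum.atMost_Suc)
  also have "\<dots> = (\<Sum>k\<le>Suc d. (-1) ^ k * of_nat (Suc d choose k) * ?r k x)"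
    by (subst sum.atMost_Suc_shift) simp
  finally show ?case .
qed

lemma rodrigues_backward_poly: "rodrigues w n C x = poly (smult C (backward_poly w n 0)) x"
  by (simp add: rodrigues_def poly_backward_poly shifted_ratio_def weight_ratio_def)

section \<open>The degree\<close>

lemma leading_factor_nonzero:
  assumes D2: "condition_D2 w" and n: "admissible_degree w n" "m + d < n"
  shows "quot_linear_u w m - quot_linear_v w m + of_nat d * quot_quadratic w m \<noteq> 0"
proof (cases w)
  case (Charlier b lb)
  then show ?thesis using D2 by simp
next
  case (Meixner b lb \<alpha>)
  then have "b \<noteq> 1" "b \<noteq> 0" using D2 by auto
  then show ?thesis using Meixner by simp
next
  case (Kravchuk N b lb)
  then have "b \<noteq> 0" "- 1 - b \<noteq> 0" using D2 by (auto simp: algebra_simps)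
  moreover from this have "- 1 - 1 / b = (- 1 - b) / b" by (simp add: diff_divide_distrib)
  ultimately show ?thesis using Kravchuk by simp
next
  case (Hahn N \<alpha> \<beta>)
  have "n \<le> N" using n Hahn by simp
  moreover have "\<forall>j. j + 2 \<le> 2 * N \<longrightarrow> - \<alpha> - \<beta> \<noteq> of_nat j"
    using D2 Hahn by simp
  \<comment> \<open>From m + d < n \<le> N follow m + 1 \<le> N and 2m + d + 2 \<le> 2N, so these
    values lie in the ranges excluded by D2.\<close>
  ultimately have "\<alpha> \<noteq> - of_nat m" "\<beta> \<noteq> - of_nat m" "- \<alpha> - \<beta> \<noteq> of_nat (2 * m + d)"
    using D2 n Hahn by (simp_all del: of_nat_add of_nat_mult)
  then have nz: "(\<alpha> + of_nat m) * (\<beta> + of_nat m) \<noteq> 0" "\<alpha> + \<beta> + of_nat (2 * m + d) \<noteq> 0"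
    unfolding mult_eq_0_iff by (auto simp: eq_neg_iff_add_eq_0 diff_eq_eq neg_eq_iff_add_eq_0 add_ac)
  have "quot_linear_u w m - quot_linear_v w m + of_nat d * quot_quadratic w m =
      - (\<alpha> + \<beta> + of_nat (2 * m + d)) / ((\<alpha> + of_nat m) * (\<beta> + of_nat m))"
    by (simp add: Hahn diff_divide_distrib[symmetric] add_divide_distrib[symmetric] algebra_simps)
  then show ?thesis using nz by (simp only: divide_eq_0_iff neg_equal_0_iff_equal simp_thms)
qed

lemma degree_backward_poly:
  assumes "condition_D2 w" "admissible_degree w n" "m + d \<le> n"
  shows "degree (backward_poly w d m) \<le> d \<and> coeff (backward_poly w d m) d \<noteq> 0"
  using assms(3)
proof (induction d arbitrary: m)
  case (Suc d)
  have IH: "degree (backward_poly w d (Suc m)) \<le> d" "coeff (backward_poly w d (Suc m)) d \<noteq> 0"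
    using Suc.IH[of "Suc m"] Suc.prems by auto
  have nz: "quot_linear_u w m - quot_linear_v w m + of_nat d * quot_quadratic w m \<noteq> 0"
    using leading_factor_nonzero[OF assms(1,2)] Suc.prems by simp
  show ?case
    using degree_coeff_backward_step[OF IH(1), of "u_quot w m 0" "quot_linear_u w m"
        "quot_quadratic w m" 0 "quot_linear_v w m"] IH(2) nz
    by (simp add: u_poly_def v_poly_def del: mult_pCons_left)
qed simp

section \<open>The weights on the nonnegative integers\<close>

text \<open>For x > N, \<open>rGamma\<close> is taken at the nonpositive integer N - x + 1. Sums
  over finite lattices thus become series over all naturals.\<close>

lemma weight_eq_0_outside:
  assumes "x \<notin> lattice_points w"
  shows "weight w 0 (of_nat x) = 0"
proof -
  have "rGamma (of_nat N - of_nat x + 1 :: complex) = 0" if "N < x" for N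
  proof -
    have "of_nat N - of_nat x + 1 = - (of_nat (x - Suc N) :: complex)"
      using that by (simp add: of_nat_diff)
    then show ?thesis by (simp only: rGamma_eq_zero_iff) simp
  qed
  then show ?thesis using assms by (cases w) auto
qed

text \<open>The point \<open>x\<close> may be singular for the formulas of \<open>weight\<close>, so
  \<open>weight_Suc_shift\<close> does not apply.\<close>
lemma pearson_weight:
  assumes "log_branch w" "condition_D2 w"
  shows "v_quot w 0 (of_nat (Suc x)) * weight w 0 (of_nat (Suc x)) =
         u_quot w 0 (of_nat x) * weight w 0 (of_nat x)"
proof -
  have rG: "(of_nat x + 1) * rGamma (of_nat x + 1 + 1 :: complex) = rGamma (of_nat x + 1)"
    by (rule rGamma_plus1)
  have e: "exp ((1 + of_nat x) * l) = exp (of_nat x * l) * exp l" for l :: complex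
    by (simp add: algebra_simps exp_add)
  show ?thesis
  proof (cases w)
    case (Charlier b lb)
    then show ?thesis using assms rG[symmetric] by (simp add: e add_ac)
  next
    case (Meixner b lb \<alpha>)
    then have "\<alpha> + of_nat x \<notin> \<int>\<^sub>\<le>\<^sub>0" using assms add_nat_notin_nonpos_Ints[of \<alpha> x] by auto
    then have "Gamma (\<alpha> + of_nat x + 1) = (\<alpha> + of_nat x) * Gamma (\<alpha> + of_nat x)"
      by (rule Gamma_plus1)
    then show ?thesis using assms Meixner rG[symmetric] by (auto simp: e add_ac)
  next
    case (Kravchuk N b lb)
    have "(of_nat N - of_nat x) * rGamma (of_nat N - of_nat x + 1) =
        rGamma (of_nat N - of_nat x :: complex)"
      by (rule rGamma_plus1)
    then show ?thesis using assms Kravchuk rG[symmetric] by (auto simp: e add_ac)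
  next
    case (Hahn N \<alpha> \<beta>)
    show ?thesis
    proof (cases "x < N")
      case True
      \<comment> \<open>With N - x = y + 1 the product formulas apply, also when \<alpha> or \<beta>
        is a nonpositive integer.\<close>
      then obtain y where N: "N = Suc (x + y)" using less_iff_Suc_add by blast
      have W: "weight w 0 (of_nat (Suc x)) =
            pochhammer \<alpha> (Suc x) * pochhammer \<beta> y / (fact (Suc x) * fact y)"
        "weight w 0 (of_nat x) =
            pochhammer \<alpha> x * pochhammer \<beta> (Suc y) / (fact x * fact (Suc y))"
        using weight_Hahn_lattice[of "Suc x" N \<alpha> \<beta>] weight_Hahn_lattice[of x N \<alpha> \<beta>]
        by (simp_all add: Hahn N Suc_diff_le del: of_nat_Suc fact_Suc)
      have uv: "v_quot w 0 (of_nat (Suc x)) = of_nat (Suc x) * (\<beta> + of_nat y) / (\<alpha> * \<beta>)"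
        "u_quot w 0 (of_nat x) = (\<alpha> + of_nat x) * of_nat (Suc y) / (\<alpha> * \<beta>)"
        by (simp_all add: Hahn N add_ac)
      show ?thesis
        unfolding W uv pochhammer_Suc fact_Suc
        by (simp add: divide_simps del: of_nat_Suc)
    next
      case False
      then have "weight w 0 (of_nat (Suc x)) = 0"
        by (intro weight_eq_0_outside) (simp add: Hahn)
      \<comment> \<open>At the right end \<open>x = N\<close> the vanishing factor is
        \<open>u_quot\<close>, not the weight.\<close>
      moreover have "u_quot w 0 (of_nat x) * weight w 0 (of_nat x) = 0"
      proof (cases "x = N")
        case True
        then show ?thesis by (simp add: Hahn)
      next
        case xN: False
        then have "weight w 0 (of_nat x) = 0"
          using False by (intro weight_eq_0_outside) (simp add: Hahn)
        then show ?thesis by simp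
      qed
      ultimately show ?thesis by simp
    qed
  qed
qed

text \<open>Ratio test for each monomial: ((x+2)/(x+1))^k tends to 1, so polynomial growth leaves
  the limit \<open>L\<close> unchanged.\<close>

lemma summable_poly_ratio:
  fixes r :: "nat \<Rightarrow> 'a::{real_normed_field}"
  assumes r: "\<And>x. norm (r (Suc x)) \<le> g x * norm (r x)" and g: "g \<longlonglongrightarrow> L" "L < 1"
  shows "summable (\<lambda>x. norm (poly p (of_nat x) * r x))"
proof -
  have pow: "summable (\<lambda>x. real (Suc x) ^ k * norm (r x))" for k
  proof -
    let ?h = "\<lambda>x. (real (Suc (Suc x)) / real (Suc x)) ^ k * g x"
    have "(\<lambda>x. real (Suc (Suc x)) / real (Suc x)) \<longlonglongrightarrow> 1"
      by real_asymp
    then have "?h \<longlonglongrightarrow> 1 ^ k * L" by (intro tendsto_intros g)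
    \<comment> \<open>The ratio (L + 1)/2 lies strictly between L and 1.\<close>
    then have "eventually (\<lambda>x. ?h x < (L + 1) / 2) sequentially"
      using g by (intro order_tendstoD) auto
    then obtain M where M: "\<And>x. x \<ge> M \<Longrightarrow> ?h x < (L + 1) / 2"
      by (auto simp: eventually_sequentially)
    show ?thesis
    proof (rule summable_ratio_test)
      fix x assume "M \<le> x"
      have "norm (real (Suc (Suc x)) ^ k * norm (r (Suc x))) \<le>
          real (Suc (Suc x)) ^ k * (g x * norm (r x))"
        using r[of x] by (simp add: mult_left_mono del: of_nat_Suc)
      also have "\<dots> = ?h x * (real (Suc x) ^ k * norm (r x))"
        by (simp add: power_divide del: of_nat_Suc)
      also have "\<dots> \<le> (L + 1) / 2 * (real (Suc x) ^ k * norm (r x))"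
        using M[OF \<open>M \<le> x\<close>] by (intro mult_right_mono) auto
      finally show "norm (real (Suc (Suc x)) ^ k * norm (r (Suc x))) \<le>
          (L + 1) / 2 * norm (real (Suc x) ^ k * norm (r x))" by simp
    qed (use g in simp)
  qed
  have "summable (\<lambda>x. \<Sum>i\<le>degree p. norm (coeff p i) * (real (Suc x) ^ i * norm (r x)))"
    by (intro summable_sum summable_mult pow)
  then show ?thesis
  proof (rule summable_comparison_test'[where N = 0])
    fix x :: nat
    have "norm (poly p (of_nat x) * r x) \<le>
        (\<Sum>i\<le>degree p. norm (coeff p i * of_nat x ^ i)) * norm (r x)"
      unfolding norm_mult[of "poly p (of_nat x)" "r x"] unfolding poly_altdef
      by (intro mult_right_mono norm_sum norm_ge_zero)
    also have "\<dots> = (\<Sum>i\<le>degree p. norm (coeff p i) * (real x ^ i * norm (r x)))"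
      by (simp add: sum_distrib_right norm_mult norm_power mult.assoc)
    also have "\<dots> \<le> (\<Sum>i\<le>degree p. norm (coeff p i) * (real (Suc x) ^ i * norm (r x)))"
      by (intro sum_mono mult_left_mono mult_right_mono power_mono) auto
    finally show "norm (norm (poly p (of_nat x) * r x)) \<le> \<dots>" by simp
  qed
qed

text \<open>By \<open>pearson_weight\<close>, ratios of consecutive weights tend to 0 (Charlier) or
  b with |b| < 1 (Meixner).\<close>

lemma summable_poly_weight:
  assumes "log_branch w" "condition_D2 w"
  shows "summable (\<lambda>x. norm (poly p (of_nat x) * weight w 0 (of_nat x)))"
proof -
  have finite_lattice: ?thesis if "finite (lattice_points w)"
    by (rule summable_finite[OF that]) (simp add: weight_eq_0_outside)
  note pearson = pearson_weight[OF assms]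
  show ?thesis
  proof (cases w)
    case (Charlier b lb)
    show ?thesis
    proof (rule summable_poly_ratio)
      show "norm (weight w 0 (of_nat (Suc x))) \<le> norm b / real (Suc x) * norm (weight w 0 (of_nat x))"
        for x
      proof -
        have "weight w 0 (of_nat (Suc x)) = b / of_nat (Suc x) * weight w 0 (of_nat x)"
          using pearson[of x] assms Charlier
          by (simp add: field_simps del: of_nat_Suc weight.simps)
        then show ?thesis by (simp add: norm_mult norm_divide del: of_nat_Suc)
      qed
      show "(\<lambda>x. norm b / real (Suc x)) \<longlonglongrightarrow> 0" by real_asymp
    qed simp
  next
    case (Meixner b lb \<alpha>)
    show ?thesis
    proof (rule summable_poly_ratio)
      \<comment> \<open>This is b (x + \<alpha>)/(x + 1), rewritten to expose its limit.\<close>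
      let ?g = "\<lambda>x. b * (1 + (\<alpha> - 1) / of_nat (Suc x))"
      show "norm (weight w 0 (of_nat (Suc x))) \<le> norm (?g x) * norm (weight w 0 (of_nat x))" for x
      proof -
        have "?g x = b * (of_nat x + \<alpha>) / of_nat (Suc x)"
          by (simp add: divide_simps del: of_nat_Suc) simp
        moreover have "weight w 0 (of_nat (Suc x)) =
            b * (of_nat x + \<alpha>) / of_nat (Suc x) * weight w 0 (of_nat x)"
          using pearson[of x] assms Meixner
          by (auto simp add: field_simps simp del: of_nat_Suc weight.simps)
        ultimately have "weight w 0 (of_nat (Suc x)) = ?g x * weight w 0 (of_nat x)" by simp
        then show ?thesis by (simp only: norm_mult order_refl)
      qed
      have "(\<lambda>x. (\<alpha> - 1) / of_nat (Suc x)) \<longlonglongrightarrow> 0"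
        by (intro LIMSEQ_Suc lim_const_over_n)
      then have "?g \<longlonglongrightarrow> b * (1 + 0)" by (intro tendsto_intros)
      then show "(\<lambda>x. norm (?g x)) \<longlonglongrightarrow> norm b" by (simp add: tendsto_norm)
      show "norm b < 1" using assms Meixner by simp
    qed
  qed (use finite_lattice in simp_all)
qed

section \<open>Orthogonality\<close>

text \<open>The values of \<open>\<rho>\<^sub>m\<close> on the nonnegative integers; \<open>weight w m\<close> itself may have junk values there.\<close>
definition lattice_weight :: "classical_weight \<Rightarrow> nat \<Rightarrow> nat \<Rightarrow> complex" where
  "lattice_weight w m x = (\<Prod>i<m. u_quot w i (of_nat x)) * weight w 0 (of_nat x)"

text \<open>Raising m multiplies in a further \<open>u\<close> factor, and
  \<open>quot_compat\<close> carries \<open>v\<close> past it.\<close>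

lemma pearson_lattice_weight:
  assumes "log_branch w" "condition_D2 w"
  shows "v_quot w m (of_nat (Suc x)) * lattice_weight w m (Suc x) = lattice_weight w (Suc m) x"
proof (induction m)
  case 0
  then show ?case using pearson_weight[OF assms, of x] by (simp add: lattice_weight_def)
next
  case (Suc m)
  let ?y = "of_nat (Suc x) :: complex"
  have "v_quot w (Suc m) ?y * lattice_weight w (Suc m) (Suc x) =
      u_quot w m ?y * v_quot w (Suc m) ?y * lattice_weight w m (Suc x)"
    by (simp add: lattice_weight_def)
  also have "\<dots> = u_quot w (Suc m) (of_nat x) * lattice_weight w (Suc m) x"
    unfolding quot_compat using Suc by (simp add: mult.assoc)
  finally show ?case by (simp add: lattice_weight_def)
qed

lemma summable_poly_lattice_weight:
  assumes "log_branch w" "condition_D2 w"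
  shows "summable (\<lambda>x. norm (poly p (of_nat x) * lattice_weight w m x))"
  using summable_poly_weight[OF assms, of "p * (\<Prod>i<m. u_poly w i)"]
  by (simp add: lattice_weight_def poly_prod poly_u_poly mult.assoc)

lemma summation_by_parts:
  assumes "log_branch w" "condition_D2 w"
  shows "(\<Sum>x. poly (q * (u_poly w m * f - v_poly w m * pcompose f [:- 1, 1:])) (of_nat x)
            * lattice_weight w m x) =
         (\<Sum>x. poly ((q - pcompose q [:1, 1:]) * f) (of_nat x) * lattice_weight w (Suc m) x)"
proof -
  let ?U = "\<lambda>x::nat. poly (q * u_poly w m * f) (of_nat x) * lattice_weight w m x"
  let ?V = "\<lambda>x::nat. poly (q * v_poly w m * pcompose f [:- 1, 1:]) (of_nat x) * lattice_weight w m x"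
  have summable: "summable (\<lambda>x. poly p (of_nat x) * lattice_weight w m x)" for p m
    by (rule summable_norm_cancel) (rule summable_poly_lattice_weight[OF assms])
  have U: "?U x = poly (q * f) (of_nat x) * lattice_weight w (Suc m) x" for x
    by (simp add: lattice_weight_def poly_u_poly)
  have V: "?V (Suc x) = poly (pcompose q [:1, 1:] * f) (of_nat x) * lattice_weight w (Suc m) x" for x
    unfolding pearson_lattice_weight[OF assms, symmetric]
    by (simp add: poly_v_poly poly_pcompose add_ac)
  \<comment> \<open>Dropping the term at 0 costs nothing because v_m(0) = 0; after the shift
    \<open>f\<close> sits at x in both series.\<close>
  have V_sum: "(\<Sum>x. ?V x) = (\<Sum>x. ?V (Suc x))"
    using suminf_split_head[OF summable[of "q * v_poly w m * pcompose f [:- 1, 1:]" m]]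
    by (simp add: poly_v_poly)
  have "(\<Sum>x. poly (q * (u_poly w m * f - v_poly w m * pcompose f [:- 1, 1:])) (of_nat x)
            * lattice_weight w m x) = (\<Sum>x. ?U x - ?V x)"
    by (simp add: algebra_simps)
  also have "\<dots> = (\<Sum>x. ?U x) - (\<Sum>x. ?V (Suc x))"
    using suminf_diff[OF summable summable] V_sum by metis
  also have "\<dots> = (\<Sum>x. poly (q * f) (of_nat x) * lattice_weight w (Suc m) x
      - poly (pcompose q [:1, 1:] * f) (of_nat x) * lattice_weight w (Suc m) x)"
    unfolding U V by (rule suminf_diff[OF summable summable])
  finally show ?thesis by (simp add: algebra_simps)
qed

lemma backward_poly_orthogonal:
  assumes "log_branch w" "condition_D2 w" "degree q < d"
  shows "(\<Sum>x. poly (q * backward_poly w d m) (of_nat x) * lattice_weight w m x) = 0"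
  using assms(3)
proof (induction d arbitrary: q m)
  case (Suc d)
  show ?case
    unfolding backward_poly.simps summation_by_parts[OF assms(1,2)]
    \<comment> \<open>Either the new test polynomial is 0 and every term vanishes, or its degree is
      below d and the induction hypothesis applies at m + 1.\<close>
    using degree_diff_pcompose_shift_less[OF Suc.prems, of 1]
      Suc.IH[of "q - pcompose q [:1, 1:]" "Suc m"]
    by auto
qed simp

theorem proposition1:
  fixes w :: classical_weight and n :: nat and C :: complex
  assumes "log_branch w" and "condition_D2 w"
    and "admissible_degree w n" and "C \<noteq> 0"
  shows "(\<exists>p :: complex poly. p \<noteq> 0 \<and> degree p = n \<and> (\<forall>x. poly p x = rodrigues w n C x)) \<and>
         (\<forall>k<n. ((\<lambda>x. rodrigues w n C (of_nat x) * of_nat x ^ k * weight w 0 (of_nat x))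
                   has_sum 0) (lattice_points w))"
proof (intro conjI allI impI)
  have deg: "degree (backward_poly w n 0) \<le> n" "coeff (backward_poly w n 0) n \<noteq> 0"
    using degree_backward_poly[OF assms(2,3), of 0 n] by auto
  then have "degree (backward_poly w n 0) = n" "backward_poly w n 0 \<noteq> 0"
    by (auto intro: antisym le_degree)
  then show "\<exists>p :: complex poly. p \<noteq> 0 \<and> degree p = n \<and> (\<forall>x. poly p x = rodrigues w n C x)"
    using assms(4) by (intro exI[of _ "smult C (backward_poly w n 0)"])
      (simp add: rodrigues_backward_poly)
next
  fix k assume k: "k < n"
  \<comment> \<open>The constant C is absorbed into the test polynomial.\<close>
  let ?q = "monom C k :: complex poly"
  let ?f = "\<lambda>x::nat. rodrigues w n C (of_nat x) * of_nat x ^ k * weight w 0 (of_nat x)"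
  have f: "?f x = poly (?q * backward_poly w n 0) (of_nat x) * lattice_weight w 0 x" for x
    by (simp add: rodrigues_backward_poly poly_monom lattice_weight_def mult_ac)
  have norm_summable: "summable (\<lambda>x. norm (?f x))"
    unfolding f by (rule summable_poly_lattice_weight[OF assms(1,2)])
  have "degree ?q < n" using degree_monom_le[of C k] k by (rule order.strict_trans1)
  then have "suminf ?f = 0"
    unfolding f by (rule backward_poly_orthogonal[OF assms(1,2)])
  then have "?f sums 0"
    using summable_sums[OF summable_norm_cancel[OF norm_summable]] by simp
  \<comment> \<open>Absolute convergence turns the ordered series into an unordered sum.\<close>
  then have "(?f has_sum 0) UNIV"
    by (rule norm_summable_imp_has_sum[OF norm_summable])
  then show "(?f has_sum 0) (lattice_points w)"
    by (subst has_sum_cong_neutral[where T = UNIV and g = ?f]) (auto simp: weight_eq_0_outside)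
qed

end
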